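(* Let $L \geq 1$ be an integer and let $X_1, X_2, \ldots$ be i.i.d. random variables, each uniformly distributed on $\{-L,\ldots,-1\}\cup\{1,\ldots,L\}$, that is $\mathbb{P}(X_i = j) = \mathbb{P}(X_i = -j) = \frac{1}{2L}$ for $j = 1,\ldots,L$. For $p \ge 1$ and $a = (a_1,\ldots,a_n) \in \mathbb{R}^n$, let $N_p(a) = \left(\mathbb{E}\left|\sum_{i=1}^n a_i X_i\right|^p\right)^{1/p}$. If $p \geq 3$, then the best (i.e. smallest) constant $C_p$ such that the inequality $N_p(a) \leq C_p N_2(a)$ holds for all positive integers $n$ and all $a \in \mathbb{R}^n$ is $C_p = \|G\|_p$, where $G$ is a standard Gaussian random variable.
   Context: For a random variable $Z$, $\|Z\|_p = (\mathbb{E}|Z|^p)^{1/p}$. A standard Gaussian random variable $G$ has density $\frac{1}{\sqrt{2\pi}}e^{-x^2/2}$ on $\mathbb{R}$, and $\|G\|_p = 2^{1/2}\left(\pi^{-1/2}\Gamma\left((p+1)/2\right)\right)^{1/p}$. *)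

theory Defs
  imports "HOL-Probability.Probability"
begin

definition moment_norm :: "'a measure \<Rightarrow> real \<Rightarrow> ('a \<Rightarrow> real) \<Rightarrow> real" where
  "moment_norm M p Z = (\<integral>\<omega>. \<bar>Z \<omega>\<bar> powr p \<partial>M) powr (1 / p)"

text \<open>
  There are \<open>2 * L\<close> atoms of mass \<open>1 / (2 * L)\<close>, so for \<open>L \<ge> 1\<close> on a probability space
  these point masses determine the law of \<open>Z\<close>.
\<close>
definition uniform_on_symmetric_range :: "'a measure \<Rightarrow> nat \<Rightarrow> ('a \<Rightarrow> real) \<Rightarrow> bool" where
  "uniform_on_symmetric_range M L Z \<longleftrightarrow>
     Z \<in> borel_measurable M \<and>
     (\<forall>j\<in>{1..L}. measure M {\<omega> \<in> space M. Z \<omega> = real j} = 1 / (2 * real L) \<and>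
                 measure M {\<omega> \<in> space M. Z \<omega> = - real j} = 1 / (2 * real L))"

text \<open>
  Vectors in \<open>\<real>\<^sup>n\<close> are represented by functions \<open>a :: nat \<Rightarrow> real\<close> of which only
  the values on \<open>{1..n}\<close> are used.
\<close>
definition weighted_sum :: "(nat \<Rightarrow> 'a \<Rightarrow> real) \<Rightarrow> nat \<Rightarrow> (nat \<Rightarrow> real) \<Rightarrow> 'a \<Rightarrow> real" where
  "weighted_sum X n a \<omega> = (\<Sum>i=1..n. a i * X i \<omega>)"

definition khinchine_bound :: "'a measure \<Rightarrow> (nat \<Rightarrow> 'a \<Rightarrow> real) \<Rightarrow> real \<Rightarrow> real \<Rightarrow> bool" where
  "khinchine_bound M X p C \<longleftrightarrow>
     (\<forall>n\<ge>1. \<forall>a. moment_norm M p (weighted_sum X n a) \<le> C * moment_norm M 2 (weighted_sum X n a))"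

end

theory Submission
  imports Defs
begin

text \<open>
  For \<open>p \<ge> 3\<close> the function \<open>u \<mapsto> (\<bar>c + t * sqrt u\<bar> powr p + \<bar>c - t * sqrt u\<bar> powr p) / 2\<close> is convex, so
  \<open>E \<bar>c + s * X\<bar> powr p\<close> is the expectation of a convex function of \<open>X\<^sup>2\<close>. In convex order, \<open>X\<^sup>2\<close> is
  dominated by \<open>V\<^sup>2\<close> with \<open>V\<close> uniform on a symmetric interval and of the same variance, and \<open>V\<^sup>2\<close> by
  \<open>\<sigma>\<^sup>2 G\<^sup>2\<close>. Hence the summands \<open>a i * X i\<close> can be replaced one at a time by Gaussians of the same
  variance. Equal weights and the central limit theorem show that the constant is optimal.
\<close>

text \<open>While one summand is replaced, the others are frozen and enter as the shift
  \<open>c\<close>, so the comparison must hold for every \<open>c\<close> and not only for the pure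
  power. Averaging over the sign of X leaves a function of the square alone. Its convexity is where
  the range of p matters: for 2 < p < 3 and nonzero \<open>c\<close> and \<open>t\<close> it already
  fails near \<open>u = 0\<close>. The uniform law is inserted because it makes both comparisons
  elementary: atoms against a density on equal pieces, and two densities whose graphs cross at only
  two values of the square. For optimality the obstacle is that convergence in law alone does not
  carry p-th moments to the limit. Only one inequality is wanted, however, and it survives
  truncation of the power at a fixed level.\<close>

section \<open>Convexity of the symmetrized power as a function of the square\<close>

text \<open>Moving both points to the right by \<open>inverse (real (Suc n))\<close> commutes with
  convex combinations, and continuity lets the shift tend to \<open>0\<close>. This supplies the
  endpoint \<open>0\<close>, where \<open>sqrt\<close> has no derivative and the derivative test
  does not apply.\<close>

lemma convex_on_atLeast_extend:
  fixes f :: "real \<Rightarrow> real"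
  assumes cv: "convex_on {a<..} f" and ct: "continuous_on {a..} f"
  shows "convex_on {a..} f"
proof (rule convex_on_linorderI)
  fix t x y :: real
  assume t: "0 < t" "t < 1" and xy: "x \<in> {a..}" "y \<in> {a..}" "x < y"
  have seq: "(\<lambda>n. inverse (real (Suc n))) \<longlonglongrightarrow> 0"
    by (rule LIMSEQ_inverse_real_of_nat)
  have conv: "(\<lambda>n. f (z + inverse (real (Suc n)))) \<longlonglongrightarrow> f z" if "z \<ge> a" for z
    using that tendsto_add[OF tendsto_const[of z] seq]
    by (intro continuous_on_tendsto_compose[OF ct]) (auto intro!: always_eventually add_increasing2)
  have mid: "(1 - t) *\<^sub>R x + t *\<^sub>R y \<ge> a"
    using t xy convex_bound_le[of "-x" "-a" "-y" "1 - t" t] by simp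
  have ineq: "f (((1 - t) *\<^sub>R x + t *\<^sub>R y) + inverse (real (Suc n)))
      \<le> (1 - t) * f (x + inverse (real (Suc n))) + t * f (y + inverse (real (Suc n)))" for n
  proof -
    let ?e = "inverse (real (Suc n))"
    have "x + ?e > a" "y + ?e > a"
      using xy by (auto intro!: add_le_less_mono[of a _ 0, simplified] simp del: of_nat_Suc)
    then have "f ((1 - t) *\<^sub>R (x + ?e) + t *\<^sub>R (y + ?e)) \<le> (1 - t) * f (x + ?e) + t * f (y + ?e)"
      using t by (intro convex_onD[OF cv]) auto
    moreover have "(1 - t) *\<^sub>R (x + ?e) + t *\<^sub>R (y + ?e) = ((1 - t) *\<^sub>R x + t *\<^sub>R y) + ?e"
      by (simp add: algebra_simps)
    ultimately show ?thesis by simp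
  qed
  show "f ((1 - t) *\<^sub>R x + t *\<^sub>R y) \<le> (1 - t) * f x + t * f y"
  proof (rule LIMSEQ_le[OF conv[OF mid]])
    show "(\<lambda>n. (1 - t) * f (x + inverse (real (Suc n))) + t * f (y + inverse (real (Suc n))))
        \<longlonglongrightarrow> (1 - t) * f x + t * f y"
      using xy by (intro tendsto_intros conv) auto
  qed (use ineq in blast)
qed simp

lemma convex_on_abs_powr:
  fixes m :: real
  assumes "m \<ge> 1"
  shows "convex_on UNIV (\<lambda>z. \<bar>z\<bar> powr m)"
proof -
  have c0: "convex_on {0..} (\<lambda>z. z powr m)"
    using assms by (intro convex_on_atLeast_extend powr_convex continuous_on_powr' continuous_intros) auto
  show ?thesis
  proof (rule convex_onI)
    fix t x y :: real assume t: "0 < t" "t < 1"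
    have "\<bar>(1 - t) *\<^sub>R x + t *\<^sub>R y\<bar> \<le> (1 - t) *\<^sub>R \<bar>x\<bar> + t *\<^sub>R \<bar>y\<bar>"
      using t abs_triangle_ineq[of "(1 - t) * x" "t * y"] by (simp add: abs_mult)
    then have "\<bar>(1 - t) *\<^sub>R x + t *\<^sub>R y\<bar> powr m \<le> ((1 - t) *\<^sub>R \<bar>x\<bar> + t *\<^sub>R \<bar>y\<bar>) powr m"
      using assms by (intro powr_mono2) auto
    also have "\<dots> \<le> (1 - t) * \<bar>x\<bar> powr m + t * \<bar>y\<bar> powr m"
      using t by (intro convex_onD[OF c0]) auto
    finally show "\<bar>(1 - t) *\<^sub>R x + t *\<^sub>R y\<bar> powr m \<le> (1 - t) * \<bar>x\<bar> powr m + t * \<bar>y\<bar> powr m" .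
  qed simp
qed

text \<open>The point \<open>x\<close> lies between \<open>- y\<close> and \<open>y\<close>, where
  \<open>f\<close> takes one common value, and convexity keeps \<open>f\<close> below that value in
  between.\<close>

lemma convex_even_mono:
  fixes f :: "real \<Rightarrow> real"
  assumes cv: "convex_on UNIV f" and ev: "\<And>z. f (- z) = f z" and xy: "0 \<le> x" "x \<le> y"
  shows "f x \<le> f y"
proof (cases "y = 0")
  case False
  define t where "t = (1 + x / y) / 2"
  have t: "0 \<le> t" "t \<le> 1" using xy False by (auto simp: t_def field_simps)
  have "x = (1 - t) *\<^sub>R (- y) + t *\<^sub>R y" using False by (simp add: t_def field_simps)
  then have "f x = f ((1 - t) *\<^sub>R (- y) + t *\<^sub>R y)" by simp
  also have "\<dots> \<le> (1 - t) * f (- y) + t * f y"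
    using t by (intro convex_onD[OF cv]) auto
  finally show ?thesis by (simp add: ev algebra_simps)
qed (use xy in auto)

text \<open>Up to the factor \<open>r\<close>, differentiation swaps the even and the odd power and
  lowers the exponent by one, so repeated derivatives need no split by sign.\<close>

lemma DERIV_abs_powr:
  fixes r z :: real
  assumes "r > 1"
  shows "((\<lambda>z. \<bar>z\<bar> powr r) has_real_derivative r * (sgn z * \<bar>z\<bar> powr (r - 1))) (at z)"
    and "((\<lambda>z. sgn z * \<bar>z\<bar> powr r) has_real_derivative r * \<bar>z\<bar> powr (r - 1)) (at z)"
proof -
  have pos: "((\<lambda>z. \<bar>z\<bar> powr r) has_real_derivative r * (sgn z * \<bar>z\<bar> powr (r - 1))) (at z)
     \<and> ((\<lambda>z. sgn z * \<bar>z\<bar> powr r) has_real_derivative r * \<bar>z\<bar> powr (r - 1)) (at z)" if "z > 0" for z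
  proof (intro conjI)
    have d: "((\<lambda>z. z powr r) has_real_derivative r * z powr (r - 1)) (at z)"
      using that by (rule has_real_derivative_powr)
    show "((\<lambda>z. \<bar>z\<bar> powr r) has_real_derivative r * (sgn z * \<bar>z\<bar> powr (r - 1))) (at z)"
      using has_field_derivative_transform_within_open[OF d, of "{0<..}" "\<lambda>z. \<bar>z\<bar> powr r"] that by auto
    show "((\<lambda>z. sgn z * \<bar>z\<bar> powr r) has_real_derivative r * \<bar>z\<bar> powr (r - 1)) (at z)"
      using has_field_derivative_transform_within_open[OF d, of "{0<..}" "\<lambda>z. sgn z * \<bar>z\<bar> powr r"] that by auto
  qed
  \<comment> \<open>With \<open>s\<close> equal to \<open>1\<close> or \<open>sgn\<close> this
    covers both functions: the difference quotient at \<open>0\<close> is at most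
    \<open>\<bar>h\<bar> powr (r - 1)\<close>, which tends to \<open>0\<close> because
    \<open>r > 1\<close>.\<close>
  have zero: "((\<lambda>z. s z * \<bar>z\<bar> powr r) has_real_derivative 0) (at 0)"
    if "\<And>z. \<bar>s z\<bar> \<le> 1" for s :: "real \<Rightarrow> real"
  proof -
    have lim: "((\<lambda>h::real. \<bar>h\<bar> powr (r - 1)) \<longlongrightarrow> \<bar>0\<bar> powr (r - 1)) (at 0)"
      using assms by (intro tendsto_powr2 tendsto_intros) auto
    have "((\<lambda>h. (s h * \<bar>h\<bar> powr r) / h) \<longlongrightarrow> 0) (at 0)"
    proof (rule Lim_null_comparison)
      show "\<forall>\<^sub>F h in at 0. norm (s h * \<bar>h\<bar> powr r / h) \<le> \<bar>h\<bar> powr (r - 1)"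
      proof (rule eventually_at_filter[THEN iffD2], rule always_eventually, intro allI impI)
        fix h :: real assume "h \<noteq> 0"
        then have "norm (s h * \<bar>h\<bar> powr r / h) = \<bar>s h\<bar> * \<bar>h\<bar> powr (r - 1)"
          by (simp add: abs_mult powr_diff)
        also have "\<dots> \<le> 1 * \<bar>h\<bar> powr (r - 1)" using that by (intro mult_right_mono) auto
        finally show "norm (s h * \<bar>h\<bar> powr r / h) \<le> \<bar>h\<bar> powr (r - 1)" by simp
      qed
    qed (use lim assms in simp)
    then show ?thesis by (simp add: DERIV_def)
  qed
  have neg1: "((\<lambda>z. \<bar>z\<bar> powr r) has_real_derivative r * (sgn z * \<bar>z\<bar> powr (r - 1))) (at z)" if "z < 0"
    using DERIV_mirror[THEN iffD1, of "\<lambda>z. \<bar>z\<bar> powr r" "r * (sgn (- z) * \<bar>z\<bar> powr (r - 1))" "z"] pos[of "-z"] that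
    by (simp add: sgn_minus)
  have neg2: "((\<lambda>z. sgn z * \<bar>z\<bar> powr r) has_real_derivative r * \<bar>z\<bar> powr (r - 1)) (at z)" if "z < 0"
    using DERIV_mirror[THEN iffD1, of "\<lambda>z. - (sgn z * \<bar>z\<bar> powr r)" "- (r * \<bar>z\<bar> powr (r - 1))" "z"]
      DERIV_minus[OF pos[of "-z", THEN conjunct2]] that
    by (simp add: sgn_minus)
  show "((\<lambda>z. \<bar>z\<bar> powr r) has_real_derivative r * (sgn z * \<bar>z\<bar> powr (r - 1))) (at z)"
    using pos[of z] neg1 zero[of "\<lambda>_. 1"] by (cases z "0::real" rule: linorder_cases) auto
  show "((\<lambda>z. sgn z * \<bar>z\<bar> powr r) has_real_derivative r * \<bar>z\<bar> powr (r - 1)) (at z)"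
    using pos[of z] neg2 zero[of sgn] by (cases z "0::real" rule: linorder_cases) (auto simp: sgn_real_def)
qed

text \<open>
  Up to a factor, the derivative in \<open>u = y\<^sup>2\<close> is \<open>Q y / y\<close>, where \<open>Q\<close> vanishes at \<open>0\<close> and is convex on
  \<open>{0..}\<close>, because \<open>Q'\<close> is even and convex (here \<open>p \<ge> 3\<close> enters) and so increasing there.
\<close>
lemma convex_on_symmetrized_abs_powr:
  fixes p c t :: real
  assumes p: "p \<ge> 3"
  shows "convex_on {0..} (\<lambda>u. (\<bar>c + t * sqrt u\<bar> powr p + \<bar>c - t * sqrt u\<bar> powr p) / 2)"
proof -
  define r where "r = p - 1"
  define \<psi> where "\<psi> = (\<lambda>z::real. sgn z * \<bar>z\<bar> powr r)"
  define Q where "Q y = \<psi> (y + c) + \<psi> (y - c)" for y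
  have odd: "\<psi> (- z) = - \<psi> z" for z by (simp add: \<psi>_def sgn_minus)
  have dQ: "(Q has_real_derivative r * (\<bar>y + c\<bar> powr (r - 1) + \<bar>y - c\<bar> powr (r - 1))) (at y)" for y
  proof -
    have d: "(\<psi> has_real_derivative r * \<bar>z\<bar> powr (r - 1)) (at z)" for z
      unfolding \<psi>_def using p by (intro DERIV_abs_powr) (simp add: r_def)
    have "((\<lambda>y. \<psi> (y + c)) has_real_derivative r * \<bar>y + c\<bar> powr (r - 1)) (at y)"
      using DERIV_shift[of \<psi> _ y c] d by blast
    moreover have "((\<lambda>y. \<psi> (y + - c)) has_real_derivative r * \<bar>y + - c\<bar> powr (r - 1)) (at y)"
      using DERIV_shift[of \<psi> _ y "- c"] d by blast
    ultimately show ?thesis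
      unfolding Q_def by (auto dest: DERIV_add simp: algebra_simps)
  qed
  have Q0: "Q 0 = 0" using odd[of c] by (simp add: Q_def)
  have cvE: "convex_on UNIV (\<lambda>y. \<bar>y + c\<bar> powr (r - 1) + \<bar>y - c\<bar> powr (r - 1))"
  proof -
    have cvm: "convex_on UNIV (\<lambda>z. \<bar>z\<bar> powr (r - 1))"
      using p by (intro convex_on_abs_powr) (simp add: r_def)
    have "convex_on UNIV (\<lambda>y. \<bar>y + d\<bar> powr (r - 1))" for d
    proof (rule convex_onI)
      fix s x y :: real assume "0 < s" "s < 1"
      moreover have "(1 - s) *\<^sub>R x + s *\<^sub>R y + d = (1 - s) *\<^sub>R (x + d) + s *\<^sub>R (y + d)"
        by (simp add: algebra_simps)
      ultimately show "\<bar>(1 - s) *\<^sub>R x + s *\<^sub>R y + d\<bar> powr (r - 1)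
          \<le> (1 - s) * \<bar>x + d\<bar> powr (r - 1) + s * \<bar>y + d\<bar> powr (r - 1)"
        using convex_onD[OF cvm, of s "x + d" "y + d"] by simp
    qed simp
    from this[of c] this[of "-c"] show ?thesis by (intro convex_on_add) auto
  qed
  have cvQ: "convex_on {0..} Q"
  proof (rule convex_on_realI[OF _ dQ])
    fix x y :: real assume "x \<in> {0..}" "x \<le> y"
    then show "r * (\<bar>x + c\<bar> powr (r - 1) + \<bar>x - c\<bar> powr (r - 1))
        \<le> r * (\<bar>y + c\<bar> powr (r - 1) + \<bar>y - c\<bar> powr (r - 1))"
      using p by (intro mult_left_mono convex_even_mono[OF cvE])
        (auto simp: r_def abs_minus_commute add.commute)
  qed simp
  \<comment> \<open>\<open>Q\<close> is convex with \<open>Q 0 = 0\<close>, so the slopes of its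
    chords from the origin increase.\<close>
  have Qdiv: "Q x / x \<le> Q y / y" if "0 < x" "x \<le> y" for x y
  proof -
    have "Q ((1 - x / y) *\<^sub>R 0 + (x / y) *\<^sub>R y) \<le> (1 - x / y) * Q 0 + (x / y) * Q y"
      using that by (intro convex_onD[OF cvQ]) auto
    then show ?thesis using that by (simp add: Q0 field_simps)
  qed
  \<comment> \<open>\<open>K\<close> is the case \<open>t = 1\<close>. A general \<open>t\<close>
    only rescales the argument to \<open>t\<^sup>2 * u\<close>, which preserves convexity; the sign
    of \<open>t\<close> merely swaps the two powers.\<close>
  define K where "K u = (\<bar>sqrt u + c\<bar> powr p + \<bar>sqrt u - c\<bar> powr p) / 2" for u
  have dK: "(K has_real_derivative p / 4 * (Q (sqrt u) / sqrt u)) (at u)" if "u > 0" for u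
  proof -
    have "((\<lambda>u. \<bar>sqrt u + d\<bar> powr p) has_real_derivative
        p * \<psi> (sqrt u + d) * (inverse (sqrt u) / 2)) (at u)" for d
    proof -
      have "((\<lambda>u. sqrt u + d) has_real_derivative inverse (sqrt u) / 2) (at u)"
        using DERIV_add[OF DERIV_real_sqrt[OF that] DERIV_const[of d]] by simp
      from DERIV_chain2[OF _ this, of "\<lambda>z. \<bar>z\<bar> powr p"] DERIV_abs_powr(1)[of p "sqrt u + d"] p
      show ?thesis by (simp add: \<psi>_def r_def)
    qed
    from DERIV_cdivide[OF DERIV_add[OF this[of c] this[of "-c"]], of 2]
    have "(K has_real_derivative (p * \<psi> (sqrt u + c) * (inverse (sqrt u) / 2)
        + p * \<psi> (sqrt u + - c) * (inverse (sqrt u) / 2)) / 2) (at u)"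
      by (simp add: K_def[abs_def])
    then show ?thesis unfolding Q_def
      by (rule DERIV_cong) (use that in \<open>simp add: field_simps\<close>)
  qed
  have cvK: "convex_on {0..} K"
  proof (rule convex_on_atLeast_extend)
    show "convex_on {0<..} K"
    proof (rule convex_on_realI[OF _ dK])
      fix x y :: real assume "x \<in> {0<..}" "x \<le> y"
      then show "p / 4 * (Q (sqrt x) / sqrt x) \<le> p / 4 * (Q (sqrt y) / sqrt y)"
        using p by (intro mult_left_mono Qdiv) auto
    qed auto
    show "continuous_on {0..} K"
      unfolding K_def using p by (intro continuous_intros continuous_on_powr') auto
  qed
  have eq: "(\<bar>c + t * sqrt u\<bar> powr p + \<bar>c - t * sqrt u\<bar> powr p) / 2 = K (t\<^sup>2 * u)" for u
    by (cases "t \<ge> 0") (auto simp: K_def real_sqrt_mult add.commute abs_minus_commute)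
  show ?thesis
    unfolding eq
  proof (rule convex_onI)
    fix s x y :: real assume *: "0 < s" "s < 1" "x \<in> {0..}" "y \<in> {0..}"
    have "t\<^sup>2 * ((1 - s) *\<^sub>R x + s *\<^sub>R y) = (1 - s) *\<^sub>R (t\<^sup>2 * x) + s *\<^sub>R (t\<^sup>2 * y)"
      by (simp add: algebra_simps)
    then show "K (t\<^sup>2 * ((1 - s) *\<^sub>R x + s *\<^sub>R y)) \<le> (1 - s) * K (t\<^sup>2 * x) + s * K (t\<^sup>2 * y)"
      using convex_onD[OF cvK, of s "t\<^sup>2 * x" "t\<^sup>2 * y"] * by simp
  qed simp
qed

section \<open>Convex order: atoms, uniform law, normal law\<close>

text \<open>\<open>D u\<close> is a subgradient, the infimum of the chord slopes to the right of
  \<open>u\<close>. Adding the supporting inequalities at \<open>u\<close> and \<open>v\<close>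
  shows that it increases. The endpoint \<open>0\<close> is left out, since a convex function may
  have slope minus infinity there.\<close>

lemma convex_on_supporting_slope:
  fixes f :: "real \<Rightarrow> real"
  assumes "convex_on {0..} f"
  obtains D where "\<And>u v. u > 0 \<Longrightarrow> v \<ge> 0 \<Longrightarrow> f u + D u * (v - u) \<le> f v"
    and "\<And>u v. 0 < u \<Longrightarrow> u \<le> v \<Longrightarrow> D u \<le> D v"
proof -
  define D where "D u = Inf ((\<lambda>t. (f u - f t) / (u - t)) ` ({u<..} \<inter> {0..}))" for u
  have D: "f u + D u * (v - u) \<le> f v" if "u > 0" "v \<ge> 0" for u v
    unfolding D_def using assms that by (intro convex_le_Inf_differential) auto
  moreover have "D u \<le> D v" if "0 < u" "u \<le> v" for u v
  proof (cases "u = v")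
    case False
    have "f u + D u * (v - u) \<le> f v" "f v + D v * (u - v) \<le> f u"
      using D[of u v] D[of v u] that by auto
    then have "(D u - D v) * (v - u) \<le> 0" by (simp add: algebra_simps)
    then show ?thesis using that False by (simp add: mult_le_0_iff)
  qed simp
  ultimately show ?thesis using that by blast
qed

text \<open>Apart from a factor \<open>k\<close>, the cross-multiplied difference is
  \<open>(L - k) * (3 * (k * L) + L + k)\<close>. This gives the sign of the partial sums in the
  summation by parts.\<close>

lemma cube_ratio_le:
  fixes k L :: real
  assumes "0 \<le> k" "k \<le> L" "L > 0"
  shows "k ^ 3 / L\<^sup>2 \<le> k * (k + 1) * (2 * k + 1) / ((L + 1) * (2 * L + 1))"
proof -
  have "k\<^sup>2 * ((L + 1) * (2 * L + 1)) \<le> (k + 1) * (2 * k + 1) * L\<^sup>2"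
  proof -
    have "(k + 1) * (2 * k + 1) * L\<^sup>2 - k\<^sup>2 * ((L + 1) * (2 * L + 1)) = (L - k) * (3 * (k * L) + L + k)"
      by (simp add: algebra_simps power2_eq_square)
    also have "\<dots> \<ge> 0" using assms by (intro mult_nonneg_nonneg add_nonneg_nonneg) auto
    finally show ?thesis by simp
  qed
  then have "k * (k\<^sup>2 * ((L + 1) * (2 * L + 1))) \<le> k * ((k + 1) * (2 * k + 1) * L\<^sup>2)"
    using assms by (intro mult_left_mono)
  then show ?thesis
    using assms by (simp add: divide_simps) (simp add: algebra_simps power2_eq_square power3_eq_cube)
qed

lemma sum_of_squares_real: "(\<Sum>j=1..k. (real j)\<^sup>2) = real k * (real k + 1) * (2 * real k + 1) / 6"
  by (induction k) (auto simp: field_simps power2_eq_square)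

text \<open>
  Cut \<open>[0, sqrt 3]\<close> into \<open>L\<close> equal pieces and bound \<open>f\<close> on the \<open>k\<close>-th piece by its supporting
  line at the \<open>k\<close>-th atom. The resulting slope terms are summed by parts: the slopes increase, while
  the partial sums \<open>S k\<close> are nonpositive and vanish at \<open>k = L\<close>.
\<close>
lemma discrete_le_continuous_uniform:
  fixes f :: "real \<Rightarrow> real" and L :: nat
  assumes cv: "convex_on {0..} f" and ct: "continuous_on {0..} f" and L: "L \<ge> 1"
  defines "v \<equiv> (real L + 1) * (2 * real L + 1) / 6"
  shows "(\<Sum>k=1..L. f ((real k)\<^sup>2 / v)) / real L \<le> integral {0..sqrt 3} (\<lambda>y. f (y\<^sup>2)) / sqrt 3"
proof -
  obtain D where D: "\<And>u w. u > 0 \<Longrightarrow> w \<ge> 0 \<Longrightarrow> f u + D u * (w - u) \<le> f w"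
    and Dm: "\<And>u w. 0 < u \<Longrightarrow> u \<le> w \<Longrightarrow> D u \<le> D w"
    using convex_on_supporting_slope[OF cv] by blast
  define h where "h = sqrt 3 / real L"
  define x where "x k = (real k)\<^sup>2 / v" for k :: nat
  \<comment> \<open>\<open>S k\<close> is the integral of \<open>y\<^sup>2\<close> over the first
    \<open>k\<close> pieces minus \<open>h\<close> times the sum of the first \<open>k\<close>
    values \<open>x j\<close>, the squared atoms scaled to mean \<open>1\<close>.\<close>
  define S where "S k = (real k * h) ^ 3 / 3 - h * (\<Sum>j=1..k. x j)" for k :: nat
  have v: "v > 0" unfolding v_def by (simp add: add_pos_nonneg)
  have h: "h > 0" using L by (simp add: h_def)
  have sumx: "(\<Sum>j=1..k. x j) = real k * (real k + 1) * (2 * real k + 1) / (6 * v)" for k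
    unfolding x_def sum_divide_distrib[symmetric] sum_of_squares_real by simp
  have S_eq: "S k = h * (real k ^ 3 / (real L)\<^sup>2
      - real k * (real k + 1) * (2 * real k + 1) / ((real L + 1) * (2 * real L + 1)))" for k
  proof -
    have "(real k * h) ^ 3 / 3 = h * (real k ^ 3 * (h\<^sup>2 / 3))"
      by (simp add: power2_eq_square power3_eq_cube)
    also have "h\<^sup>2 / 3 = 1 / (real L)\<^sup>2" by (simp add: h_def power_divide)
    finally show ?thesis unfolding S_def sumx by (simp add: v_def right_diff_distrib)
  qed
  have S_le: "S k \<le> 0" if "k \<le> L" for k
    unfolding S_eq using cube_ratio_le[of "real k" "real L"] that h L
    by (intro mult_nonneg_nonpos) auto
  have S_L: "S L = 0"
    unfolding S_eq using L by (simp add: power2_eq_square power3_eq_cube divide_simps) 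
  have cts: "continuous_on A (\<lambda>y. f (y\<^sup>2))" for A
    by (rule continuous_on_compose2[OF ct]) (auto intro: continuous_intros)
  have int: "(\<lambda>y. f (y\<^sup>2)) integrable_on {a..b}" for a b
    by (intro integrable_continuous_interval cts)
  \<comment> \<open>\<open>D (x k) * S k\<close> is the boundary term left by summation by parts
    after \<open>k\<close> pieces. The value \<open>D 0\<close> that occurs at \<open>k = 0\<close>
    is unconstrained, but its factor \<open>S 0\<close> is \<open>0\<close>.\<close>
  have main: "h * (\<Sum>j=1..k. f (x j)) + D (x k) * S k \<le> integral {0..real k * h} (\<lambda>y. f (y\<^sup>2))"
    if "k \<le> L" for k
    using that
  proof (induction k)
    case 0
    then show ?case by (simp add: S_def)
  next
    case (Suc k)
    let ?a = "real k * h" and ?b = "real (Suc k) * h"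
    have ab: "0 \<le> ?a" "?a \<le> ?b" using h by (auto simp: mult_right_mono)
    have xpos: "x (Suc k) > 0" using v by (simp add: x_def)
    let ?l = "\<lambda>y. f (x (Suc k)) + D (x (Suc k)) * (y\<^sup>2 - x (Suc k))"
    let ?P = "\<lambda>y. f (x (Suc k)) * y + D (x (Suc k)) * (y ^ 3 / 3 - x (Suc k) * y)"
    have "(?l has_integral ?P ?b - ?P ?a) {?a..?b}"
      using ab by (intro fundamental_theorem_of_calculus)
        (auto intro!: derivative_eq_intros simp flip: has_real_derivative_iff_has_vector_derivative)
    moreover have "((\<lambda>y. f (y\<^sup>2)) has_integral integral {?a..?b} (\<lambda>y. f (y\<^sup>2))) {?a..?b}"
      using int by (rule integrable_integral)
    ultimately have "?P ?b - ?P ?a \<le> integral {?a..?b} (\<lambda>y. f (y\<^sup>2))"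
      by (rule has_integral_le) (rule D[OF xpos zero_le_power2])
    moreover have "?P ?b - ?P ?a = h * f (x (Suc k)) + D (x (Suc k)) * (S (Suc k) - S k)"
    proof -
      have "?b - ?a = h" by (simp add: algebra_simps)
      moreover have "S (Suc k) - S k = (?b ^ 3 - ?a ^ 3) / 3 - h * x (Suc k)"
        by (simp add: S_def distrib_left diff_divide_distrib del: of_nat_Suc)
      moreover have "?P ?b - ?P ?a
          = (?b - ?a) * f (x (Suc k)) + D (x (Suc k)) * ((?b ^ 3 - ?a ^ 3) / 3 - (?b - ?a) * x (Suc k))"
        unfolding diff_divide_distrib left_diff_distrib right_diff_distrib by simp
      ultimately show ?thesis by simp
    qed
    moreover have "D (x (Suc k)) * S k \<le> D (x k) * S k"
    proof (cases "k = 0")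
      case False
      then have "D (x k) \<le> D (x (Suc k))"
        using v by (intro Dm) (auto simp: x_def divide_right_mono power_mono)
      then show ?thesis using S_le[of k] Suc.prems by (intro mult_right_mono_neg) auto
    qed (simp add: S_def)
    moreover have "integral {0..?a} (\<lambda>y. f (y\<^sup>2)) + integral {?a..?b} (\<lambda>y. f (y\<^sup>2))
        = integral {0..?b} (\<lambda>y. f (y\<^sup>2))"
      using ab by (intro Henstock_Kurzweil_Integration.integral_combine int) auto
    moreover have "h * (\<Sum>j=1..k. f (x j)) + D (x k) * S k \<le> integral {0..?a} (\<lambda>y. f (y\<^sup>2))"
      using Suc by simp
    moreover have "h * (\<Sum>j=1..Suc k. f (x j)) = h * (\<Sum>j=1..k. f (x j)) + h * f (x (Suc k))"
      by (simp add: distrib_left)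
    ultimately show ?case unfolding right_diff_distrib by linarith
  qed
  have "h * (\<Sum>k=1..L. f (x k)) \<le> integral {0..sqrt 3} (\<lambda>y. f (y\<^sup>2))"
    using main[of L] L by (simp add: S_L h_def)
  then have "h * (\<Sum>k=1..L. f (x k)) / sqrt 3 \<le> integral {0..sqrt 3} (\<lambda>y. f (y\<^sup>2)) / sqrt 3"
    by (rule divide_right_mono) simp
  then show ?thesis by (simp add: h_def x_def)
qed

text \<open>
  The standard normal density and the uniform density on \<open>[- sqrt 3, sqrt 3]\<close> have the same mass and
  second moment and cross where \<open>y\<^sup>2\<close> is \<open>w = ln (6 / pi)\<close> or \<open>3\<close>. Subtracting from \<open>f\<close> the chord through
  these two points makes the integrand of the difference nonnegative.
\<close>
lemma continuous_uniform_le_normal: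
  fixes f :: "real \<Rightarrow> real"
  assumes cv: "convex_on {0..} f" and ct: "continuous_on {0..} f"
    and int: "integrable lborel (\<lambda>y. std_normal_density y * f (y\<^sup>2))"
  shows "integral {0..sqrt 3} (\<lambda>y. f (y\<^sup>2)) / sqrt 3 \<le> (\<integral>y. std_normal_density y * f (y\<^sup>2) \<partial>lborel)"
proof -
  \<comment> \<open>Equating the normal density with the uniform height
    \<open>1 / (2 * sqrt 3)\<close> gives \<open>exp (w / 2) = sqrt (6 / pi)\<close> for
    \<open>w = y\<^sup>2\<close>.\<close>
  define w where "w = ln (6 / pi)"
  have w0: "0 < w" unfolding w_def using pi_less_4 by (intro ln_gt_zero) (auto simp: field_simps)
  have w3: "w < 3"
  proof -
    have "w \<le> 6 / pi - 1" unfolding w_def by (intro ln_le_minus_one) auto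
    also have "\<dots> < 3" using pi_gt3 by (simp add: field_simps)
    finally show ?thesis .
  qed
  define \<alpha> where "\<alpha> = (f 3 - f w) / (3 - w)"
  define l where "l u = f w + \<alpha> * (u - w)" for u
  have l3: "l 3 = f 3" and lw: "l w = f w" using w3 by (auto simp: l_def \<alpha>_def)
  have chord: "f u \<le> l u" if "w \<le> u" "u \<le> 3" for u
    using convex_onD_Icc'[OF convex_on_subset[OF cv], of w 3 u] that w0 w3
    by (simp add: l_def \<alpha>_def algebra_simps)
  \<comment> \<open>Outside \<open>{w..3}\<close> the inequality reverses: a convex function lies
    above the extension of its chord.\<close>
  have out: "f u \<ge> l u" if "u \<ge> 0" "u < w \<or> 3 < u" for u
  proof (cases "u < w")
    case True
    have "(f u - f w) / (u - w) \<le> (f u - f 3) / (u - 3)"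
      using convex_on_slope_le[OF cv, of u 3 w] True that w0 w3 by auto
    then have "f w * (3 - u) \<le> f u * (3 - w) + f 3 * (w - u)"
      using True w3 by (simp add: divide_simps) (simp add: algebra_simps)
    then show ?thesis using w3 by (simp add: l_def \<alpha>_def divide_simps) (simp add: algebra_simps)
  next
    case False
    then have "3 < u" using that by auto
    then have "(f w - f 3) / (w - 3) \<le> (f w - f u) / (w - u)"
      using convex_on_slope_le[OF cv, of w u 3] w0 w3 by auto
    then have "f 3 * (u - w) \<le> f w * (u - 3) + f u * (3 - w)"
      using \<open>3 < u\<close> w3 by (simp add: divide_simps) (simp add: algebra_simps)
    then show ?thesis using w3 by (simp add: l_def \<alpha>_def divide_simps) (simp add: algebra_simps)
  qed
  define I where "I = {- sqrt 3..sqrt 3}"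
  define c where "c = 1 / (2 * sqrt 3)"
  have c: "c > 0" by (simp add: c_def)
  \<comment> \<open>Factoring out the uniform height \<open>c\<close> shows the sign of the density
    difference inside \<open>I\<close>: it is that of \<open>w - y\<^sup>2\<close>.\<close>
  have dens: "std_normal_density y = c * exp ((w - y\<^sup>2) / 2)" for y
  proof -
    have "exp (w / 2) = sqrt (6 / pi)"
      by (rule power2_eq_imp_eq) (auto simp: w_def simp flip: exp_of_nat_mult)
    moreover have "c * sqrt (6 / pi) = 1 / sqrt (2 * pi)"
    proof (rule power2_eq_imp_eq)
      show "(c * sqrt (6 / pi))\<^sup>2 = (1 / sqrt (2 * pi))\<^sup>2"
        by (simp add: c_def power_mult_distrib power_divide)
    qed (use c in auto)
    moreover have "exp ((w - y\<^sup>2) / 2) = exp (w / 2) * exp (- (y\<^sup>2 / 2))"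
      unfolding exp_add[symmetric] by (simp add: diff_divide_distrib)
    ultimately show ?thesis
      by (simp add: std_normal_density_def mult.assoc[symmetric])
  qed
  define \<delta> where "\<delta> y = std_normal_density y - c * indicator I y" for y
  have inI: "y \<in> I \<longleftrightarrow> y\<^sup>2 \<le> 3" for y
    unfolding I_def using abs_le_square_iff[of y "sqrt 3"] by auto
  have sgn: "\<delta> y * (f (y\<^sup>2) - l (y\<^sup>2)) \<ge> 0" for y
  proof -
    consider "y\<^sup>2 < w" | "w \<le> y\<^sup>2" "y\<^sup>2 \<le> 3" | "3 < y\<^sup>2" by linarith
    then show ?thesis
    proof cases
      case 1
      then have "\<delta> y = c * (exp ((w - y\<^sup>2) / 2) - 1)" using w3 by (simp add: \<delta>_def dens inI algebra_simps indicator_def)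
      then have "\<delta> y \<ge> 0" using 1 c by simp
      then show ?thesis using out[of "y\<^sup>2"] 1 by simp
    next
      case 2
      then have "\<delta> y = c * (exp ((w - y\<^sup>2) / 2) - 1)" by (simp add: \<delta>_def dens inI algebra_simps indicator_def)
      then have "\<delta> y \<le> 0" using 2 c by (simp add: mult_le_0_iff)
      then show ?thesis using chord[of "y\<^sup>2"] 2 by (simp add: mult_nonpos_nonpos)
    next
      case 3
      then have "\<delta> y \<ge> 0" by (simp add: \<delta>_def inI)
      then show ?thesis using out[of "y\<^sup>2"] 3 by simp
    qed
  qed
  have cts: "continuous_on A (\<lambda>y. f (y\<^sup>2))" for A
    by (rule continuous_on_compose2[OF ct]) (auto intro: continuous_intros)
  have intI: "integrable lborel (\<lambda>y. indicator I y * g y)" "(\<integral>y. indicator I y * g y \<partial>lborel) = integral I g"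
    if "continuous_on I g" for g :: "real \<Rightarrow> real"
    using borel_integrable_atLeastAtMost'[of "- sqrt 3" "sqrt 3" g] that
      set_borel_integral_eq_integral(2)[of I g]
    by (auto simp: I_def set_integrable_def set_lebesgue_integral_def)
  have ints: "integrable lborel (\<lambda>y. std_normal_density y * y\<^sup>2)" "integrable lborel std_normal_density"
    using integrable_std_normal_moment[of 2] by auto
  have mom: "(\<integral>y. std_normal_density y * y\<^sup>2 \<partial>lborel) = 1" "(\<integral>y. std_normal_density y \<partial>lborel) = 1"
    using integral_std_normal_moment_even[of 1] by (auto simp: fact_numeral)
  have unif: "integral I (\<lambda>y. y\<^sup>2) = 2 * sqrt 3" "integral I (\<lambda>y. 1) = 2 * sqrt 3"
  proof -
    have "((\<lambda>y. y\<^sup>2) has_integral ((sqrt 3) ^ 3 / 3 - (- sqrt 3) ^ 3 / 3)) I"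
      unfolding I_def by (intro fundamental_theorem_of_calculus)
        (auto intro!: derivative_eq_intros simp flip: has_real_derivative_iff_has_vector_derivative)
    then show "integral I (\<lambda>y. y\<^sup>2) = 2 * sqrt 3"
      by (simp add: integral_unique power3_eq_cube)
  qed (simp add: I_def)
  have l_eq: "l (y\<^sup>2) = (f w - \<alpha> * w) + \<alpha> * y\<^sup>2" for y by (simp add: l_def algebra_simps)
  have "continuous_on I (\<lambda>y::real. y\<^sup>2)" "continuous_on I (\<lambda>y. 1 :: real)" by (auto intro: continuous_intros)
  note i2 = intI[OF this(1)] and i0 = intI[OF this(2)] and iF = intI[OF cts]
  \<comment> \<open>The bracket collects the contribution of \<open>l\<close>. It integrates to
    \<open>0\<close>, since \<open>c * (2 * sqrt 3) = 1\<close> gives both densities mass and second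
    moment \<open>1\<close>.\<close>
  have eq: "\<delta> y * (f (y\<^sup>2) - l (y\<^sup>2)) = std_normal_density y * f (y\<^sup>2) - c * (indicator I y * f (y\<^sup>2))
      - ((f w - \<alpha> * w) * (std_normal_density y - c * (indicator I y * 1))
        + \<alpha> * (std_normal_density y * y\<^sup>2 - c * (indicator I y * y\<^sup>2)))" for y
    by (simp add: \<delta>_def l_eq algebra_simps)
  have "0 \<le> (\<integral>y. \<delta> y * (f (y\<^sup>2) - l (y\<^sup>2)) \<partial>lborel)"
    using sgn by (intro integral_nonneg_AE) auto
  also have "\<dots> = (\<integral>y. std_normal_density y * f (y\<^sup>2) \<partial>lborel) - c * integral I (\<lambda>y. f (y\<^sup>2))
      - ((f w - \<alpha> * w) * (1 - c * (2 * sqrt 3)) + \<alpha> * (1 - c * (2 * sqrt 3)))"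
    unfolding eq using int ints i2 i0 iF
    by (subst Bochner_Integration.integral_diff Bochner_Integration.integral_add integral_mult_right_zero
      | intro Bochner_Integration.integrable_diff Bochner_Integration.integrable_add integrable_mult_right
      | simp only: mom unif)+
  finally have "c * integral I (\<lambda>y. f (y\<^sup>2)) \<le> (\<integral>y. std_normal_density y * f (y\<^sup>2) \<partial>lborel)"
    by (simp add: c_def)
  moreover have "integral I (\<lambda>y. f (y\<^sup>2)) = 2 * integral {0..sqrt 3} (\<lambda>y. f (y\<^sup>2))"
  proof -
    have "integral {- sqrt 3..0} (\<lambda>y. f (y\<^sup>2)) = integral {0..sqrt 3} (\<lambda>y. f (y\<^sup>2))"
      using Henstock_Kurzweil_Integration.integral_reflect_real[of "sqrt 3" 0 "\<lambda>y. f (y\<^sup>2)"] by simp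
    moreover have "integral {- sqrt 3..0} (\<lambda>y. f (y\<^sup>2)) + integral {0..sqrt 3} (\<lambda>y. f (y\<^sup>2)) = integral I (\<lambda>y. f (y\<^sup>2))"
      unfolding I_def by (intro Henstock_Kurzweil_Integration.integral_combine
        integrable_continuous_interval cts) auto
    ultimately show ?thesis by simp
  qed
  ultimately show ?thesis by (simp add: c_def)
qed

section \<open>Gaussian integrals and sums of independent Gaussians\<close>

interpretation std_normal: prob_space std_normal_distribution
  by (rule prob_space_normal_density) simp

lemma integral_std_normal_reflect:
  fixes g :: "real \<Rightarrow> real"
  assumes [measurable]: "g \<in> borel_measurable borel"
  shows "(LINT y|std_normal_distribution. g (- y)) = (LINT y|std_normal_distribution. g y)"
proof -
  have "(LINT y|std_normal_distribution. g y) = (\<integral>y. std_normal_density y * g y \<partial>lborel)"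
    by (subst integral_density) auto
  also have "\<dots> = (\<integral>y. std_normal_density y * g (- y) \<partial>lborel)"
    by (subst lborel_integral_real_affine[where c = "-1" and t = 0]) (auto simp: std_normal_density_def)
  also have "\<dots> = (LINT y|std_normal_distribution. g (- y))"
    by (subst integral_density) auto
  finally show ?thesis by simp
qed

text \<open>A real power is at most \<open>1\<close> plus an integer power of higher or equal degree
  \<open>m\<close>, whose integral is a combination of normal moments.\<close>

lemma integrable_std_normal_abs_powr:
  fixes c s p :: real
  assumes p: "p \<ge> 0"
  shows "integrable std_normal_distribution (\<lambda>y. \<bar>c + s * y\<bar> powr p)"
proof -
  define m where "m = nat \<lceil>p\<rceil>"
  have pm: "p \<le> real m" unfolding m_def by linarith
  have "integrable std_normal_distribution (\<lambda>y. 1 + \<bar>c\<bar> ^ m * 2 ^ m + 2 ^ m * \<bar>s\<bar> ^ m * \<bar>y\<bar> ^ m)"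
    using integrable_std_normal_distribution_moment[of m, THEN integrable_abs]
    by (intro Bochner_Integration.integrable_add integrable_mult_right) (auto simp: power_abs)
  then show ?thesis
  proof (rule Bochner_Integration.integrable_bound)
    show "AE y in std_normal_distribution.
      norm (\<bar>c + s * y\<bar> powr p) \<le> norm (1 + \<bar>c\<bar> ^ m * 2 ^ m + 2 ^ m * \<bar>s\<bar> ^ m * \<bar>y\<bar> ^ m)"
    proof (rule AE_I2)
      fix y :: real
      define b where "b = \<bar>c + s * y\<bar>"
      have "b powr p \<le> 1 + b ^ m"
      proof (cases "b \<le> 1")
        case True
        then have "b powr p \<le> 1 powr p" using p by (intro powr_mono2) (auto simp: b_def)
        then show ?thesis by (simp add: b_def add_increasing2)
      next
        case False
        then have "b powr p \<le> b powr real m" using pm by (intro powr_mono) auto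
        then show ?thesis using False by (simp add: powr_realpow)
      qed
      also have "b ^ m \<le> (2 * max \<bar>c\<bar> \<bar>s * y\<bar>) ^ m"
        unfolding b_def by (intro power_mono) (auto simp: max_def)
      also have "\<dots> = 2 ^ m * max \<bar>c\<bar> \<bar>s * y\<bar> ^ m" by (simp add: power_mult_distrib)
      also have "\<dots> \<le> 2 ^ m * (\<bar>c\<bar> ^ m + \<bar>s * y\<bar> ^ m)" by (intro mult_left_mono) (auto simp: max_def)
      also have "\<dots> = \<bar>c\<bar> ^ m * 2 ^ m + 2 ^ m * \<bar>s\<bar> ^ m * \<bar>y\<bar> ^ m"
        by (simp add: abs_mult power_mult_distrib algebra_simps)
      finally show "norm (\<bar>c + s * y\<bar> powr p) \<le> norm (1 + \<bar>c\<bar> ^ m * 2 ^ m + 2 ^ m * \<bar>s\<bar> ^ m * \<bar>y\<bar> ^ m)"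
        by (simp add: b_def)
    qed
  qed simp
qed

text \<open>The coordinates of a product measure are independent, and here each is standard normal.
  Nonzero coefficients ensure that each scaled coordinate still has a density.\<close>

lemma distributed_std_normal_pair:
  fixes \<rho> \<tau> :: real
  assumes "\<rho> \<noteq> 0" "\<tau> \<noteq> 0"
  shows "distributed (std_normal_distribution \<Otimes>\<^sub>M std_normal_distribution) lborel
    (\<lambda>x. \<rho> * fst x + \<tau> * snd x) (normal_density 0 (sqrt (\<rho>\<^sup>2 + \<tau>\<^sup>2)))"
proof -
  define N where "N = std_normal_distribution"
  have setsN [measurable_cong, simp]: "sets N = sets borel" by (simp add: N_def)
  interpret N: prob_space N unfolding N_def by (rule std_normal.prob_space_axioms)
  interpret P: pair_prob_space N N ..
  have dfst: "distr (N \<Otimes>\<^sub>M N) N fst = N" by (rule N.distr_pair_fst)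
  have dsnd: "distr (N \<Otimes>\<^sub>M N) N snd = N"
  proof (rule measure_eqI)
    fix A assume "A \<in> sets (distr (N \<Otimes>\<^sub>M N) N snd)"
    then have A: "A \<in> sets N" by simp
    then have "snd -` A \<inter> space (N \<Otimes>\<^sub>M N) = space N \<times> A"
      using sets.sets_into_space[OF A] by (auto simp: space_pair_measure)
    then show "emeasure (distr (N \<Otimes>\<^sub>M N) N snd) A = emeasure N A"
      using A N.emeasure_pair_measure_Times[OF sets.top[of N] A]
      by (simp add: emeasure_distr N.emeasure_space_1)
  qed simp
  have dist: "distributed (N \<Otimes>\<^sub>M N) lborel X std_normal_density"
    if "distr (N \<Otimes>\<^sub>M N) N X = N" "X \<in> measurable (N \<Otimes>\<^sub>M N) N" for X
  proof -
    have "distr (N \<Otimes>\<^sub>M N) lborel X = distr (N \<Otimes>\<^sub>M N) N X" by (rule distr_cong) simp_all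
    then show ?thesis using that by (auto simp: distributed_def N_def)
  qed
  have "P.indep_var N fst N snd"
    unfolding P.indep_var_distribution_eq by (simp add: dfst dsnd distr_id[unfolded id_def])
  then have "P.indep_var borel ((\<lambda>y. \<rho> * y) \<circ> fst) borel ((\<lambda>y. \<tau> * y) \<circ> snd)"
    by (rule P.indep_var_compose) simp_all
  moreover have "distributed (N \<Otimes>\<^sub>M N) lborel (\<lambda>x. \<rho> * fst x) (normal_density 0 \<bar>\<rho>\<bar>)"
    using P.normal_density_affine[OF dist[OF dfst], of \<rho> 0] assms by simp
  moreover have "distributed (N \<Otimes>\<^sub>M N) lborel (\<lambda>x. \<tau> * snd x) (normal_density 0 \<bar>\<tau>\<bar>)"
    using P.normal_density_affine[OF dist[OF dsnd], of \<tau> 0] assms by simp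
  ultimately show ?thesis
    using P.add_indep_normal[of "\<lambda>x. \<rho> * fst x" "\<lambda>x. \<tau> * snd x" "\<bar>\<rho>\<bar>" "\<bar>\<tau>\<bar>" 0 0] assms
    by (simp add: comp_def N_def)
qed

text \<open>In this iterated form, two successive Gaussian replacements merge into one.
  Integrability of the inner integral is recorded for the later use of monotonicity in the outer
  one.\<close>

lemma integral_std_normal_add:
  fixes g :: "real \<Rightarrow> real" and \<rho> \<tau> :: real
  assumes g[measurable]: "g \<in> borel_measurable borel" and \<rho>: "\<rho> \<ge> 0"
    and int: "integrable std_normal_distribution (\<lambda>y. g (sqrt (\<rho>\<^sup>2 + \<tau>\<^sup>2) * y))"
  shows "(LINT y|std_normal_distribution. LINT z|std_normal_distribution. g (\<rho> * y + \<tau> * z))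
    = (LINT y|std_normal_distribution. g (sqrt (\<rho>\<^sup>2 + \<tau>\<^sup>2) * y))"
    and "integrable std_normal_distribution (\<lambda>y. LINT z|std_normal_distribution. g (\<rho> * y + \<tau> * z))"
proof -
  have refl: "(LINT y|std_normal_distribution. g (\<bar>\<tau>\<bar> * y)) = (LINT y|std_normal_distribution. g (\<tau> * y))"
    using integral_std_normal_reflect[of "\<lambda>y. g (\<tau> * y)"] by (cases "\<tau> \<ge> 0") (auto simp: abs_if)
  define N where "N = std_normal_distribution"
  have setsN [measurable_cong, simp]: "sets N = sets borel" by (simp add: N_def)
  interpret N: prob_space N unfolding N_def by (rule std_normal.prob_space_axioms)
  interpret P: pair_prob_space N N ..
  have "(LINT y|N. LINT z|N. g (\<rho> * y + \<tau> * z)) = (LINT y|N. g (sqrt (\<rho>\<^sup>2 + \<tau>\<^sup>2) * y))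
    \<and> integrable N (\<lambda>y. LINT z|N. g (\<rho> * y + \<tau> * z))"
  proof -
    \<comment> \<open>With a vanishing coefficient one scaled coordinate has no density. For
      \<open>\<rho> = 0\<close> the remaining \<open>\<tau>\<close> may be negative, which
      reflection repairs.\<close>
    consider "\<rho> = 0" | "\<tau> = 0" | "\<rho> \<noteq> 0" "\<tau> \<noteq> 0" by blast
    then show ?thesis
    proof cases
      case 1
      then show ?thesis using refl by (simp add: N_def std_normal.prob_space[simplified])
    next
      case 2
      then show ?thesis using \<rho> int by (simp add: N_def std_normal.prob_space[simplified])
    next
      case 3
      define \<sigma> where "\<sigma> = sqrt (\<rho>\<^sup>2 + \<tau>\<^sup>2)"
      \<comment> \<open>\<open>W\<close> is the combination normalized to unit variance, hence
        standard normal; the claim becomes Fubini for \<open>g (\<sigma> * W x)\<close>.\<close>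
      define W where "W = (\<lambda>x. (\<rho> * fst x + \<tau> * snd x) / \<sigma>)"
      have \<sigma>: "\<sigma> > 0" using 3 by (simp add: \<sigma>_def add_pos_pos)
      have "distributed (N \<Otimes>\<^sub>M N) lborel W std_normal_density"
        using distributed_std_normal_pair[OF 3] P.normal_standard_normal_convert[OF \<sigma>, of _ 0]
        by (simp add: \<sigma>_def W_def N_def)
      moreover have "distr (N \<Otimes>\<^sub>M N) borel W = distr (N \<Otimes>\<^sub>M N) lborel W" by (rule distr_cong) simp_all
      ultimately have dW: "distr (N \<Otimes>\<^sub>M N) borel W = N"
        by (simp add: distributed_def N_def)
      have [measurable]: "W \<in> measurable (N \<Otimes>\<^sub>M N) borel" unfolding W_def by measurable
      have gW: "g (\<sigma> * W (y, z)) = g (\<rho> * y + \<tau> * z)" for y z using \<sigma> by (simp add: W_def)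
      have i: "integrable (distr (N \<Otimes>\<^sub>M N) borel W) (\<lambda>y. g (\<sigma> * y))"
        using int by (simp add: dW) (simp add: N_def \<sigma>_def)
      then have "integrable (N \<Otimes>\<^sub>M N) (\<lambda>x. g (\<sigma> * W x))"
        by (subst (asm) integrable_distr_eq) auto
      then have i': "integrable (N \<Otimes>\<^sub>M N) (\<lambda>(y, z). g (\<rho> * y + \<tau> * z))"
        by (rule back_subst[where P = "integrable _"]) (auto simp: gW[symmetric])
      have "(LINT y|N. g (\<sigma> * y)) = (LINT y|distr (N \<Otimes>\<^sub>M N) borel W. g (\<sigma> * y))" by (simp add: dW)
      also have "\<dots> = (LINT x|(N \<Otimes>\<^sub>M N). g (\<sigma> * W x))" by (rule integral_distr) auto
      also have "\<dots> = (LINT x|(N \<Otimes>\<^sub>M N). (case x of (y, z) \<Rightarrow> g (\<rho> * y + \<tau> * z)))"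
        by (rule arg_cong[where f = "integral\<^sup>L _"]) (auto simp: gW[symmetric])
      also have "\<dots> = (LINT y|N. LINT z|N. g (\<rho> * y + \<tau> * z))"
        by (rule P.integral_fst[symmetric]) (rule i')
      finally show ?thesis using P.integrable_fst[OF i'] by (simp add: \<sigma>_def)
    qed
  qed
  then show "(LINT y|std_normal_distribution. LINT z|std_normal_distribution. g (\<rho> * y + \<tau> * z))
    = (LINT y|std_normal_distribution. g (sqrt (\<rho>\<^sup>2 + \<tau>\<^sup>2) * y))"
    and "integrable std_normal_distribution (\<lambda>y. LINT z|std_normal_distribution. g (\<rho> * y + \<tau> * z))"
    by (simp_all add: N_def)
qed

section \<open>Averages over the range and replacement of the summands\<close>

definition symmetric_range :: "nat \<Rightarrow> real set" where
  "symmetric_range L = real ` {1..L} \<union> (\<lambda>j. - real j) ` {1..L}"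

text \<open>The expectation under the law of a single \<open>X i\<close>. As a finite sum it needs
  no probability space and commutes with integrals by linearity.\<close>

definition range_mean :: "nat \<Rightarrow> (real \<Rightarrow> real) \<Rightarrow> real" where
  "range_mean L g = (\<Sum>r\<in>symmetric_range L. g r) / (2 * real L)"

lemma finite_symmetric_range [simp]: "finite (symmetric_range L)"
  by (simp add: symmetric_range_def)

lemma sum_symmetric_range:
  fixes g :: "real \<Rightarrow> 'b::comm_monoid_add"
  shows "(\<Sum>r\<in>symmetric_range L. g r) = (\<Sum>j=1..L. g (real j) + g (- real j))"
proof -
  have "real ` {1..L} \<inter> (\<lambda>j. - real j) ` {1..L} = {}" by auto
  then show ?thesis
    unfolding symmetric_range_def
    by (subst sum.union_disjoint) (auto simp: sum.reindex inj_on_def sum.distrib)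
qed

lemma card_symmetric_range: "card (symmetric_range L) = 2 * L"
  using sum_symmetric_range[of "\<lambda>_. 1 :: nat" L] by simp

lemma range_mean_mono:
  "(\<And>r. r \<in> symmetric_range L \<Longrightarrow> g r \<le> h r) \<Longrightarrow> range_mean L g \<le> range_mean L h"
  unfolding range_mean_def by (intro divide_right_mono sum_mono) auto

text \<open>The second moment of \<open>X i\<close>, which is its variance because the law is
  symmetric.\<close>

definition range_variance :: "nat \<Rightarrow> real" where
  "range_variance L = (real L + 1) * (2 * real L + 1) / 6"

lemma range_variance_pos: "range_variance L > 0"
  by (simp add: range_variance_def add_pos_nonneg)

lemma range_mean_square:
  assumes "L \<ge> 1"
  shows "range_mean L (\<lambda>x. (c + s * x)\<^sup>2) = c\<^sup>2 + range_variance L * s\<^sup>2"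
proof -
  have "(c + s * x)\<^sup>2 + (c + s * - x)\<^sup>2 = 2 * c\<^sup>2 + 2 * s\<^sup>2 * x\<^sup>2" for x
    by (simp add: power2_eq_square algebra_simps)
  then have "range_mean L (\<lambda>x. (c + s * x)\<^sup>2) = (\<Sum>j=1..L. 2 * c\<^sup>2 + 2 * s\<^sup>2 * (real j)\<^sup>2) / (2 * real L)"
    unfolding range_mean_def sum_symmetric_range by simp
  also have "\<dots> = (2 * c\<^sup>2 * real L + 2 * s\<^sup>2 * (\<Sum>j=1..L. (real j)\<^sup>2)) / (2 * real L)"
    by (simp only: sum.distrib sum_distrib_left[symmetric] sum_constant card_atLeastAtMost) simp
  also have "\<dots> = c\<^sup>2 + range_variance L * s\<^sup>2"
    unfolding sum_of_squares_real range_variance_def using assms by (simp add: field_simps)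
  finally show ?thesis .
qed

text \<open>Pairing \<open>x\<close> with \<open>- x\<close> turns both sides into averages of one
  convex function \<open>f\<close> of the square, so the two comparisons chain through the uniform
  law.\<close>

lemma range_mean_abs_powr_le_normal:
  fixes c s p :: real
  assumes p: "p \<ge> 3" and L: "L \<ge> 1"
  shows "range_mean L (\<lambda>x. \<bar>c + s * x\<bar> powr p)
    \<le> (LINT y|std_normal_distribution. \<bar>c + s * sqrt (range_variance L) * y\<bar> powr p)"
proof -
  define v where "v = range_variance L"
  have v: "v > 0" by (simp add: v_def range_variance_pos)
  \<comment> \<open>The factor \<open>sqrt v\<close> moves the standard deviation into the
    coefficient: the squared atoms become \<open>(real k)\<^sup>2 / v\<close>, with mean
    \<open>1\<close> as for a standard normal.\<close>
  define t where "t = s * sqrt v"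
  define f where "f u = (\<bar>c + t * sqrt u\<bar> powr p + \<bar>c - t * sqrt u\<bar> powr p) / 2" for u
  have cv: "convex_on {0..} f"
    unfolding f_def by (rule convex_on_symmetrized_abs_powr[OF p])
  have ct: "continuous_on {0..} f"
    unfolding f_def using p by (intro continuous_intros continuous_on_powr') auto
  have f_sq: "f (y\<^sup>2) = (\<bar>c + t * y\<bar> powr p + \<bar>c + t * - y\<bar> powr p) / 2" for y
    by (cases "y \<ge> 0") (auto simp: f_def)
  have f_atom: "f ((real k)\<^sup>2 / v) = (\<bar>c + s * real k\<bar> powr p + \<bar>c + s * - real k\<bar> powr p) / 2" for k
    using v by (simp add: f_def t_def real_sqrt_divide)
  have int: "integrable std_normal_distribution (\<lambda>y. \<bar>c + t * y\<bar> powr p)"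
    "integrable std_normal_distribution (\<lambda>y. \<bar>c + t * - y\<bar> powr p)"
    using integrable_std_normal_abs_powr[of p c t] integrable_std_normal_abs_powr[of p c "- t"] p by auto
  then have "integrable std_normal_distribution (\<lambda>y. f (y\<^sup>2))"
    unfolding f_sq by (intro integrable_divide Bochner_Integration.integrable_add)
  then have intf: "integrable lborel (\<lambda>y. std_normal_density y * f (y\<^sup>2))"
    by (subst (asm) integrable_density) (auto simp: f_def)
  have "range_mean L (\<lambda>x. \<bar>c + s * x\<bar> powr p) = (\<Sum>k=1..L. f ((real k)\<^sup>2 / v)) / real L"
    unfolding range_mean_def sum_symmetric_range f_atom by (simp flip: sum_divide_distrib)
  also have "\<dots> \<le> integral {0..sqrt 3} (\<lambda>y. f (y\<^sup>2)) / sqrt 3"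
    unfolding v_def range_variance_def by (rule discrete_le_continuous_uniform[OF cv ct L])
  also have "\<dots> \<le> (\<integral>y. std_normal_density y * f (y\<^sup>2) \<partial>lborel)"
    by (rule continuous_uniform_le_normal[OF cv ct intf])
  also have "\<dots> = (LINT y|std_normal_distribution. f (y\<^sup>2))"
    by (subst integral_density) (auto simp: f_def)
  also have "\<dots> = ((LINT y|std_normal_distribution. \<bar>c + t * y\<bar> powr p)
      + (LINT y|std_normal_distribution. \<bar>c + t * - y\<bar> powr p)) / 2"
    unfolding f_sq using int by simp
  also have "\<dots> = (LINT y|std_normal_distribution. \<bar>c + t * y\<bar> powr p)"
    using integral_std_normal_reflect[of "\<lambda>y. \<bar>c + t * y\<bar> powr p"] by simp
  finally show ?thesis by (simp add: t_def v_def)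
qed

text \<open>For independent uniform \<open>X i\<close> this is the expectation of
  \<open>F (c + weighted_sum X n a \<omega>)\<close>, with the last index averaged outermost;
  \<open>c\<close> collects the summands already fixed.\<close>

primrec iterated_mean :: "nat \<Rightarrow> (nat \<Rightarrow> real) \<Rightarrow> (real \<Rightarrow> real) \<Rightarrow> nat \<Rightarrow> real \<Rightarrow> real" where
  "iterated_mean L a F 0 c = F c"
| "iterated_mean L a F (Suc n) c = range_mean L (\<lambda>x. iterated_mean L a F n (c + a (Suc n) * x))"

lemma iterated_mean_square:
  assumes "L \<ge> 1"
  shows "iterated_mean L a (\<lambda>x. x\<^sup>2) n c = c\<^sup>2 + range_variance L * (\<Sum>i=1..n. (a i)\<^sup>2)"
proof (induction n arbitrary: c)
  case (Suc n)
  let ?d = "range_variance L * (\<Sum>i=1..n. (a i)\<^sup>2)"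
  have "range_mean L (\<lambda>x. (c + a (Suc n) * x)\<^sup>2 + ?d) = range_mean L (\<lambda>x. (c + a (Suc n) * x)\<^sup>2) + ?d"
    using assms by (simp add: range_mean_def sum.distrib card_symmetric_range add_divide_distrib)
  then show ?case by (simp add: Suc range_mean_square[OF assms] distrib_left)
qed simp

text \<open>For each value of the last summand the induction hypothesis, at a shifted
  \<open>c\<close>, replaces the earlier ones by one Gaussian. For each value of that Gaussian the
  last summand is replaced in turn, and the two Gaussians merge.\<close>

lemma iterated_mean_abs_powr_le_normal:
  fixes c p :: real
  assumes p: "p \<ge> 3" and L: "L \<ge> 1"
  shows "iterated_mean L a (\<lambda>x. \<bar>x\<bar> powr p) n c
    \<le> (LINT y|std_normal_distribution. \<bar>c + sqrt (range_variance L * (\<Sum>i=1..n. (a i)\<^sup>2)) * y\<bar> powr p)"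
proof (induction n arbitrary: c)
  case 0
  then show ?case by (simp add: std_normal.prob_space[simplified])
next
  case (Suc n)
  define \<rho> where "\<rho> = sqrt (range_variance L * (\<Sum>i=1..n. (a i)\<^sup>2))"
  define \<tau> where "\<tau> = a (Suc n) * sqrt (range_variance L)"
  have \<rho>: "\<rho> \<ge> 0" "\<rho>\<^sup>2 = range_variance L * (\<Sum>i=1..n. (a i)\<^sup>2)"
    using range_variance_pos[of L] by (auto simp: \<rho>_def sum_nonneg)
  have sq: "\<rho>\<^sup>2 + \<tau>\<^sup>2 = range_variance L * (\<Sum>i=1..Suc n. (a i)\<^sup>2)"
    using range_variance_pos[of L] \<rho>(2) by (simp add: \<tau>_def power_mult_distrib algebra_simps)
  let ?g = "\<lambda>x. \<bar>c + x\<bar> powr p"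
  have "integrable std_normal_distribution (\<lambda>y. ?g (sqrt (\<rho>\<^sup>2 + \<tau>\<^sup>2) * y))"
    using p by (intro integrable_std_normal_abs_powr) auto
  note add = integral_std_normal_add[OF _ \<rho>(1) this]
  have int: "integrable std_normal_distribution (\<lambda>y. \<bar>c + a (Suc n) * x + \<rho> * y\<bar> powr p)" for x
    using p by (intro integrable_std_normal_abs_powr) auto
  have eq: "c + a (Suc n) * x + \<rho> * y = (c + \<rho> * y) + a (Suc n) * x" for x y by simp
  have "iterated_mean L a (\<lambda>x. \<bar>x\<bar> powr p) (Suc n) c
      \<le> range_mean L (\<lambda>x. LINT y|std_normal_distribution. \<bar>c + a (Suc n) * x + \<rho> * y\<bar> powr p)"
    using Suc by (auto intro!: range_mean_mono simp: \<rho>_def)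
  \<comment> \<open>Taking the Gaussian outermost makes \<open>c + \<rho> * y\<close> the shift of
    the single-summand comparison.\<close>
  also have "\<dots> = (LINT y|std_normal_distribution. range_mean L (\<lambda>x. \<bar>(c + \<rho> * y) + a (Suc n) * x\<bar> powr p))"
    unfolding range_mean_def eq[symmetric]
    using int by (subst Bochner_Integration.integral_divide) (auto simp: Bochner_Integration.integral_sum)
  also have "\<dots> \<le> (LINT y|std_normal_distribution. LINT z|std_normal_distribution. ?g (\<rho> * y + \<tau> * z))"
  proof (rule integral_mono)
    show "integrable std_normal_distribution (\<lambda>y. range_mean L (\<lambda>x. \<bar>(c + \<rho> * y) + a (Suc n) * x\<bar> powr p))"
      unfolding range_mean_def eq[symmetric]
      using int by (intro integrable_divide Bochner_Integration.integrable_sum) auto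
    show "range_mean L (\<lambda>x. \<bar>c + \<rho> * y + a (Suc n) * x\<bar> powr p)
        \<le> (LINT z|std_normal_distribution. ?g (\<rho> * y + \<tau> * z))" for y
      using range_mean_abs_powr_le_normal[OF p L, of "c + \<rho> * y" "a (Suc n)"]
      by (simp add: \<tau>_def add.assoc)
  qed (rule add(2), simp)
  also have "\<dots> = (LINT y|std_normal_distribution. ?g (sqrt (\<rho>\<^sup>2 + \<tau>\<^sup>2) * y))"
    by (rule add(1)) simp
  finally show ?case unfolding sq .
qed

section \<open>From the random variables to finite averages\<close>

context prob_space
begin

lemma uniform_on_symmetric_range_atom:
  assumes "uniform_on_symmetric_range M L Z" "r \<in> symmetric_range L"
  shows "prob {\<omega> \<in> space M. Z \<omega> = r} = 1 / (2 * real L)"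
  using assms by (auto simp: uniform_on_symmetric_range_def symmetric_range_def)

lemma uniform_on_symmetric_range_AE:
  assumes Z: "uniform_on_symmetric_range M L Z" and L: "L \<ge> 1"
  shows "AE \<omega> in M. Z \<omega> \<in> symmetric_range L"
proof -
  have [measurable]: "Z \<in> borel_measurable M"
    using Z by (simp add: uniform_on_symmetric_range_def)
  define A where "A r = {\<omega> \<in> space M. Z \<omega> = r}" for r
  have "prob (\<Union>r\<in>symmetric_range L. A r) = (\<Sum>r\<in>symmetric_range L. prob (A r))"
    by (intro finite_measure_finite_Union) (auto simp: A_def disjoint_family_on_def)
  also have "\<dots> = 1"
    using L by (simp add: A_def uniform_on_symmetric_range_atom[OF Z] card_symmetric_range)
  finally have "AE \<omega> in M. \<omega> \<in> (\<Union>r\<in>symmetric_range L. A r)"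
    by (rule AE_prob_1)
  then show ?thesis by eventually_elim (auto simp: A_def)
qed

lemma expectation_uniform_atom:
  assumes Z: "uniform_on_symmetric_range M L Z" and r: "r \<in> symmetric_range L"
  shows "expectation (\<lambda>\<omega>. indicator {r} (Z \<omega>) :: real) = 1 / (2 * real L)"
proof -
  have "expectation (\<lambda>\<omega>. indicator {r} (Z \<omega>) :: real) = expectation (indicator {\<omega> \<in> space M. Z \<omega> = r})"
    by (intro Bochner_Integration.integral_cong) (auto simp: indicator_def)
  also have "\<dots> = prob {\<omega> \<in> space M. Z \<omega> = r}"
    by simp (rule arg_cong[where f = prob], auto)
  finally show ?thesis by (simp add: uniform_on_symmetric_range_atom[OF Z r])
qed

text \<open>Almost surely \<open>Z\<close> takes one of finitely many values, so the integrand is a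
  finite sum of products of an indicator in \<open>Z\<close> and a function of \<open>Y\<close>.
  Independence factors each product.\<close>

lemma expectation_indep_uniform:
  fixes g :: "real \<Rightarrow> real \<Rightarrow> real"
  assumes Z: "uniform_on_symmetric_range M L Z" and L: "L \<ge> 1"
    and ind: "indep_var borel Z borel Y"
    and g[measurable]: "case_prod g \<in> borel_measurable (borel \<Otimes>\<^sub>M borel)"
    and int: "\<And>r. r \<in> symmetric_range L \<Longrightarrow> integrable M (\<lambda>\<omega>. g r (Y \<omega>))"
  shows "integrable M (\<lambda>\<omega>. g (Z \<omega>) (Y \<omega>))"
    and "expectation (\<lambda>\<omega>. g (Z \<omega>) (Y \<omega>)) = range_mean L (\<lambda>r. expectation (\<lambda>\<omega>. g r (Y \<omega>)))"
proof -
  have [measurable]: "Z \<in> borel_measurable M" "Y \<in> borel_measurable M"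
    using ind by (auto simp: indep_var_distribution_eq)
  let ?i = "\<lambda>r \<omega>. indicator {r} (Z \<omega>) :: real"
  have AE: "AE \<omega> in M. g (Z \<omega>) (Y \<omega>) = (\<Sum>r\<in>symmetric_range L. ?i r \<omega> * g r (Y \<omega>))"
    using uniform_on_symmetric_range_AE[OF Z L]
    by eventually_elim (auto simp: indicator_def if_distrib cong: if_cong)
  have ii: "integrable M (?i r)" for r
    by (rule integrable_const_bound[where B = 1]) auto
  have indr: "indep_var borel (?i r) borel (\<lambda>\<omega>. g r (Y \<omega>))" for r
    using indep_var_compose[OF ind, of "indicator {r}" borel "g r" borel] by (simp add: comp_def)
  have prod: "integrable M (\<lambda>\<omega>. ?i r \<omega> * g r (Y \<omega>))"
    "expectation (\<lambda>\<omega>. ?i r \<omega> * g r (Y \<omega>)) = 1 / (2 * real L) * expectation (\<lambda>\<omega>. g r (Y \<omega>))"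
    if "r \<in> symmetric_range L" for r
    using indep_var_integrable[OF indr ii int[OF that]]
      indep_var_lebesgue_integral[OF indr ii int[OF that]]
      expectation_uniform_atom[OF Z that] by auto
  have int_sum: "integrable M (\<lambda>\<omega>. \<Sum>r\<in>symmetric_range L. ?i r \<omega> * g r (Y \<omega>))"
    using prod by (intro Bochner_Integration.integrable_sum) auto
  then show "integrable M (\<lambda>\<omega>. g (Z \<omega>) (Y \<omega>))"
    by (subst integrable_cong_AE[OF _ borel_measurable_integrable AE]) auto
  have "expectation (\<lambda>\<omega>. g (Z \<omega>) (Y \<omega>)) = expectation (\<lambda>\<omega>. \<Sum>r\<in>symmetric_range L. ?i r \<omega> * g r (Y \<omega>))"
    by (rule integral_cong_AE[OF _ borel_measurable_integrable[OF int_sum] AE]) simp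
  also have "\<dots> = (\<Sum>r\<in>symmetric_range L. 1 / (2 * real L) * expectation (\<lambda>\<omega>. g r (Y \<omega>)))"
    using prod by (subst Bochner_Integration.integral_sum) auto
  finally show "expectation (\<lambda>\<omega>. g (Z \<omega>) (Y \<omega>)) = range_mean L (\<lambda>r. expectation (\<lambda>\<omega>. g r (Y \<omega>)))"
    by (simp add: range_mean_def sum_divide_distrib)
qed

lemma expectation_uniform:
  fixes f :: "real \<Rightarrow> real"
  assumes Z: "uniform_on_symmetric_range M L Z" and L: "L \<ge> 1" and [measurable]: "f \<in> borel_measurable borel"
  shows "integrable M (\<lambda>\<omega>. f (Z \<omega>))" and "expectation (\<lambda>\<omega>. f (Z \<omega>)) = range_mean L f"
proof -
  have [measurable]: "Z \<in> borel_measurable M"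
    using Z by (simp add: uniform_on_symmetric_range_def)
  let ?s = "\<lambda>\<omega>. \<Sum>r\<in>symmetric_range L. indicator {r} (Z \<omega>) * f r"
  have AE: "AE \<omega> in M. f (Z \<omega>) = ?s \<omega>"
    using uniform_on_symmetric_range_AE[OF Z L]
    by eventually_elim (auto simp: indicator_def if_distrib cong: if_cong)
  have ii: "integrable M (\<lambda>\<omega>. indicator {r} (Z \<omega>) * f r)" for r
    by (intro integrable_mult_left integrable_const_bound[where B = 1]) auto
  then have int_sum: "integrable M ?s"
    by (intro Bochner_Integration.integrable_sum)
  then show "integrable M (\<lambda>\<omega>. f (Z \<omega>))"
    by (subst integrable_cong_AE[OF _ borel_measurable_integrable AE]) auto
  have "expectation (\<lambda>\<omega>. f (Z \<omega>)) = expectation ?s"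
    by (rule integral_cong_AE[OF _ borel_measurable_integrable[OF int_sum] AE]) simp
  also have "\<dots> = (\<Sum>r\<in>symmetric_range L. 1 / (2 * real L) * f r)"
    using ii by (subst Bochner_Integration.integral_sum) (auto simp: expectation_uniform_atom[OF Z])
  finally show "expectation (\<lambda>\<omega>. f (Z \<omega>)) = range_mean L f"
    by (simp add: range_mean_def sum_divide_distrib)
qed

text \<open>Supplies the identical distribution for the central limit theorem: each Borel set has as
  its mass the range mean of its indicator.\<close>

lemma distr_uniform_eq:
  assumes Z: "uniform_on_symmetric_range M L Z" and Z': "uniform_on_symmetric_range M L Z'" and L: "L \<ge> 1"
  shows "distr M borel Z = distr M borel Z'"
proof (rule measure_eqI)
  have [measurable]: "Z \<in> borel_measurable M" "Z' \<in> borel_measurable M"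
    using Z Z' by (simp_all add: uniform_on_symmetric_range_def)
  fix A assume "A \<in> sets (distr M borel Z)"
  then have A[measurable]: "A \<in> sets borel" by simp
  have "emeasure (distr M borel W) A = ennreal (range_mean L (indicator A))"
    if W: "uniform_on_symmetric_range M L W" for W
  proof -
    have [measurable]: "W \<in> borel_measurable M"
      using W by (simp add: uniform_on_symmetric_range_def)
    have "range_mean L (indicator A) = expectation (\<lambda>\<omega>. indicator A (W \<omega>))"
      using expectation_uniform(2)[OF W L, of "indicator A"] by simp
    also have "\<dots> = expectation (indicator (W -` A \<inter> space M))"
      by (intro Bochner_Integration.integral_cong) (auto simp: indicator_def)
    also have "\<dots> = prob (W -` A \<inter> space M)" by simp
    finally show ?thesis by (simp add: emeasure_distr emeasure_eq_measure)
  qed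
  then show "emeasure (distr M borel Z) A = emeasure (distr M borel Z') A" using Z Z' by simp
qed simp

text \<open>Integrability is part of the induction because splitting off the next summand assumes it
  at every atom.\<close>

lemma expectation_weighted_sum:
  fixes F :: "real \<Rightarrow> real" and X :: "nat \<Rightarrow> 'a \<Rightarrow> real"
  assumes ind: "indep_vars (\<lambda>_. borel) X {1..}" and L: "L \<ge> 1"
    and unif: "\<And>i. i \<ge> 1 \<Longrightarrow> uniform_on_symmetric_range M L (X i)"
    and [measurable]: "F \<in> borel_measurable borel"
  shows "integrable M (\<lambda>\<omega>. F (c + weighted_sum X n a \<omega>)) \<and>
    expectation (\<lambda>\<omega>. F (c + weighted_sum X n a \<omega>)) = iterated_mean L a F n c"
proof (induction n arbitrary: c)
  case 0
  then show ?case by (simp add: weighted_sum_def prob_space)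
next
  case (Suc n)
  have "indep_vars (\<lambda>_. borel) X (insert (Suc n) {1..n})"
    by (rule indep_vars_subset[OF ind]) auto
  \<comment> \<open>Only indices up to \<open>n\<close> are scaled, so that \<open>X (Suc n)\<close>
    itself comes out independent of the weighted sum of the others.\<close>
  then have "indep_vars (\<lambda>_. borel) (\<lambda>i \<omega>. (if i \<le> n then a i * X i \<omega> else X i \<omega>)) (insert (Suc n) {1..n})"
    by (rule indep_vars_compose2[where Y = "\<lambda>i x. if i \<le> n then a i * x else x"]) auto
  then have "indep_var borel (X (Suc n)) borel (\<lambda>\<omega>. \<Sum>i=1..n. if i \<le> n then a i * X i \<omega> else X i \<omega>)"
    using indep_vars_sum[of "{1..n}" "Suc n" "\<lambda>i \<omega>. if i \<le> n then a i * X i \<omega> else X i \<omega>"] by simp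
  then have iv: "indep_var borel (X (Suc n)) borel (weighted_sum X n a)"
    by (rule back_subst[where P = "indep_var _ _ _"]) (auto simp: weighted_sum_def intro!: sum.cong)
  let ?g = "\<lambda>r y. F (c + a (Suc n) * r + y)"
  have g: "case_prod ?g \<in> borel_measurable (borel \<Otimes>\<^sub>M borel)" by measurable
  have "integrable M (\<lambda>\<omega>. ?g (X (Suc n) \<omega>) (weighted_sum X n a \<omega>)) \<and>
    expectation (\<lambda>\<omega>. ?g (X (Suc n) \<omega>) (weighted_sum X n a \<omega>)) = iterated_mean L a F (Suc n) c"
    using expectation_indep_uniform[OF unif L iv g] Suc by simp
  then show ?case by (simp add: weighted_sum_def algebra_simps)
qed

end

section \<open>Limit law and the optimal constant\<close>

lemma integral_distributed_std_normal:
  fixes g :: "real \<Rightarrow> real"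
  assumes "distributed M lborel G std_normal_density" "g \<in> borel_measurable borel"
  shows "(\<integral>\<omega>. g (G \<omega>) \<partial>M) = (LINT y|std_normal_distribution. g y)"
  using distributed_integral[OF assms(1), of g] assms(2)
  by (subst integral_density) auto

text \<open>Serves the shift by \<open>Suc\<close>: the variables are numbered from
  \<open>1\<close>, while the central limit theorem sums from \<open>0\<close>. A finite family of
  events is carried along the inverse of \<open>f\<close>.\<close>

lemma (in prob_space) indep_vars_reindex_inj:
  assumes ind: "indep_vars M' X I" and f: "inj_on f J" "f ` J \<subseteq> I"
  shows "indep_vars (\<lambda>j. M' (f j)) (\<lambda>j. X (f j)) J"
  unfolding indep_vars_def2
proof (intro conjI ballI indep_setsI)
  let ?E = "\<lambda>i. {X i -` A \<inter> space M |A. A \<in> sets (M' i)}"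
  have E: "indep_sets ?E I" using ind by (simp add: indep_vars_def2)
  show rv: "random_variable (M' (f j)) (X (f j))" if "j \<in> J" for j
    using ind f that by (auto simp: indep_vars_def2)
  show "?E (f j) \<subseteq> events" if "j \<in> J" for j
    using rv[OF that] by (auto intro: measurable_sets)
  fix A K assume K: "K \<noteq> {}" "K \<subseteq> J" "finite K" and A: "\<forall>j\<in>K. A j \<in> ?E (f j)"
  have injK: "inj_on f K" using f K by (blast intro: inj_on_subset)
  define B where "B i = A (the_inv_into K f i)" for i
  have B: "B (f j) = A j" if "j \<in> K" for j
    using that by (simp add: B_def the_inv_into_f_f[OF injK])
  have "prob (\<Inter>i\<in>f ` K. B i) = (\<Prod>i\<in>f ` K. prob (B i))"
    using K f A by (intro indep_setsD[OF E]) (auto simp: B)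
  then show "prob (\<Inter>j\<in>K. A j) = (\<Prod>j\<in>K. prob (A j))"
    by (simp add: prod.reindex[OF injK] B)
qed

lemma (in prob_space) weighted_sum_central_limit:
  fixes X :: "nat \<Rightarrow> 'a \<Rightarrow> real"
  assumes ind: "indep_vars (\<lambda>_. borel) X {1..}" and L: "L \<ge> 1"
    and unif: "\<And>i. i \<ge> 1 \<Longrightarrow> uniform_on_symmetric_range M L (X i)"
  shows "weak_conv_m (\<lambda>n. distr M borel (weighted_sum X n (\<lambda>_. 1 / sqrt (real n * range_variance L))))
    std_normal_distribution"
proof -
  define \<sigma> where "\<sigma> = sqrt (range_variance L)"
  have \<sigma>: "\<sigma> > 0" "\<sigma>\<^sup>2 = range_variance L" using range_variance_pos[of L] by (auto simp: \<sigma>_def)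
  have ind': "indep_vars (\<lambda>_. borel) (\<lambda>i. X (Suc i)) UNIV"
    by (rule indep_vars_reindex_inj[OF ind]) auto
  have mean: "expectation (X (Suc n)) = 0" for n
    using expectation_uniform(2)[OF unif L, of "Suc n" "\<lambda>x. x"]
    by (simp add: range_mean_def sum_symmetric_range)
  have sq: "integrable M (\<lambda>\<omega>. (X (Suc n) \<omega>)\<^sup>2)" "expectation (\<lambda>\<omega>. (X (Suc n) \<omega>)\<^sup>2) = \<sigma>\<^sup>2" for n
    using expectation_uniform[OF unif L, of "Suc n" "\<lambda>x. x\<^sup>2"] range_mean_square[OF L, of 0 1] by (auto simp: \<sigma>)
  have "weak_conv_m (\<lambda>n. distr M borel (\<lambda>x. (\<Sum>i<n. X (Suc i) x) / sqrt (n * \<sigma>\<^sup>2))) std_normal_distribution"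
    by (rule central_limit_theorem_zero_mean[OF ind' mean \<sigma>(1) sq(1) _
          distr_uniform_eq[OF unif unif[of 1] L]]) (auto simp: mean sq)
  \<comment> \<open>At \<open>n = 0\<close> both functions are \<open>0\<close>, the sums being
    empty and \<open>0 / 0\<close> being \<open>0\<close>.\<close>
  also have "(\<lambda>n. distr M borel (\<lambda>x. (\<Sum>i<n. X (Suc i) x) / sqrt (n * \<sigma>\<^sup>2)))
    = (\<lambda>n. distr M borel (weighted_sum X n (\<lambda>_. 1 / sqrt (real n * range_variance L))))"
    by (simp add: weighted_sum_def[abs_def] \<sigma> sum.atLeast1_atMost_eq sum_divide_distrib)
  finally show ?thesis .
qed

text \<open>Weak convergence controls only bounded continuous functions. Dominated convergence, with
  the full power as bound, removes the truncation.\<close>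

lemma std_normal_abs_powr_le_of_truncated:
  assumes p: "p \<ge> 0"
    and le: "\<And>k::nat. (LINT y|std_normal_distribution. min (\<bar>y\<bar> powr p) (real k)) \<le> B"
  shows "(LINT y|std_normal_distribution. \<bar>y\<bar> powr p) \<le> B"
proof (rule LIMSEQ_le_const2)
  have int: "integrable std_normal_distribution (\<lambda>y. \<bar>y\<bar> powr p)"
    using integrable_std_normal_abs_powr[OF p, of 0 1] by simp
  show "(\<lambda>k. LINT y|std_normal_distribution. min (\<bar>y\<bar> powr p) (real k))
    \<longlonglongrightarrow> (LINT y|std_normal_distribution. \<bar>y\<bar> powr p)"
  proof (rule integral_dominated_convergence[OF _ _ int])
    show "AE y in std_normal_distribution. (\<lambda>k. min (\<bar>y\<bar> powr p) (real k)) \<longlonglongrightarrow> \<bar>y\<bar> powr p"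
    proof (rule AE_I2)
      fix y :: real
      have "\<forall>\<^sub>F k in sequentially. min (\<bar>y\<bar> powr p) (real k) = \<bar>y\<bar> powr p"
        using eventually_ge_at_top[of "nat \<lceil>\<bar>y\<bar> powr p\<rceil>"] by eventually_elim (rule min_absorb1, linarith)
      then show "(\<lambda>k. min (\<bar>y\<bar> powr p) (real k)) \<longlonglongrightarrow> \<bar>y\<bar> powr p"
        by (rule tendsto_eventually)
    qed
  qed auto
qed (use le in auto)

theorem theorem3:
  fixes M :: "'a measure" and X :: "nat \<Rightarrow> 'a \<Rightarrow> real"
    and M' :: "'b measure" and G :: "'b \<Rightarrow> real"
    and L :: nat and p :: real
  assumes "L \<ge> 1"
    and "prob_space M"
    and "prob_space.indep_vars M (\<lambda>_. borel) X {1..}"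
    and "\<And>i. i \<ge> 1 \<Longrightarrow> uniform_on_symmetric_range M L (X i)"
    and "prob_space M'"
    and "distributed M' lborel G std_normal_density"
    and "p \<ge> 3"
  shows "khinchine_bound M X p (moment_norm M' p G) \<and>
         (\<forall>C. khinchine_bound M X p C \<longrightarrow> moment_norm M' p G \<le> C)"
proof -
  interpret prob_space M by fact
  note L = assms(1) and ind = assms(3) and unif = assms(4) and p = assms(7)
  define m where "m = (LINT y|std_normal_distribution. \<bar>y\<bar> powr p)"
  \<comment> \<open>\<open>\<rho> n a\<close> is both the second moment norm of the weighted sum and
    the standard deviation of the Gaussian replacing it.\<close>
  define \<rho> where "\<rho> n a = sqrt (range_variance L * (\<Sum>i=1..n. (a i)\<^sup>2))" for n and a :: "nat \<Rightarrow> real"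
  have m0: "m \<ge> 0" unfolding m_def by (rule integral_nonneg_AE) auto
  have normG: "moment_norm M' p G = m powr (1 / p)"
    unfolding moment_norm_def m_def
    by (subst integral_distributed_std_normal[OF assms(6), of "\<lambda>y. \<bar>y\<bar> powr p"]) auto
  have norm2: "moment_norm M 2 (weighted_sum X n a) = \<rho> n a" for n a
  proof -
    have "moment_norm M 2 (weighted_sum X n a) = sqrt (expectation (\<lambda>\<omega>. (0 + weighted_sum X n a \<omega>)\<^sup>2))"
      by (simp add: moment_norm_def powr_half_sqrt integral_nonneg_AE)
    then show ?thesis
      using expectation_weighted_sum[OF ind L unif, of "\<lambda>x. x\<^sup>2" 0 n a]
      by (simp add: iterated_mean_square[OF L] \<rho>_def)
  qed
  have \<rho>0: "\<rho> n a \<ge> 0" for n a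
    using range_variance_pos[of L] by (auto simp: \<rho>_def sum_nonneg)
  have upper: "khinchine_bound M X p (moment_norm M' p G)"
    unfolding khinchine_bound_def
  proof (intro allI impI)
    fix n :: nat and a :: "nat \<Rightarrow> real"
    have "expectation (\<lambda>\<omega>. \<bar>weighted_sum X n a \<omega>\<bar> powr p) = iterated_mean L a (\<lambda>x. \<bar>x\<bar> powr p) n 0"
      using expectation_weighted_sum[OF ind L unif, of "\<lambda>x. \<bar>x\<bar> powr p" 0 n a] by simp
    also have "\<dots> \<le> (LINT y|std_normal_distribution. \<bar>0 + \<rho> n a * y\<bar> powr p)"
      unfolding \<rho>_def by (rule iterated_mean_abs_powr_le_normal[OF p L])
    also have "\<dots> = \<rho> n a powr p * m"
      using \<rho>0[of n a] by (simp add: m_def abs_mult powr_mult)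
    finally have "moment_norm M p (weighted_sum X n a) \<le> (\<rho> n a powr p * m) powr (1 / p)"
      unfolding moment_norm_def using p by (intro powr_mono2) (auto intro: integral_nonneg_AE)
    also have "\<dots> = m powr (1 / p) * \<rho> n a"
      using \<rho>0[of n a] m0 p by (simp add: powr_mult powr_powr)
    finally show "moment_norm M p (weighted_sum X n a)
        \<le> moment_norm M' p G * moment_norm M 2 (weighted_sum X n a)"
      by (simp add: normG norm2)
  qed
  have lower: "moment_norm M' p G \<le> C" if C: "khinchine_bound M X p C" for C
  proof -
    \<comment> \<open>Equal weights, scaled so that for \<open>n \<ge> 1\<close> the second moment
      norm is \<open>1\<close> and the assumed inequality bounds the p-th norm by \<open>C\<close>
      itself.\<close>
    let ?a = "\<lambda>n _. 1 / sqrt (real n * range_variance L)"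
    define T where "T n = weighted_sum X n (?a n)" for n
    have [measurable]: "X i \<in> borel_measurable M" if "i \<ge> 1" for i
      using unif[OF that] by (simp add: uniform_on_symmetric_range_def)
    have T_meas [measurable]: "T n \<in> borel_measurable M" for n
      unfolding T_def weighted_sum_def[abs_def] by (rule borel_measurable_sum) simp
    have bound: "moment_norm M p (T n) \<le> C" if "n \<ge> 1" for n
    proof -
      have "\<rho> n (?a n) = 1"
        using that range_variance_pos[of L] by (simp add: \<rho>_def power_divide)
      then show ?thesis
        using C[unfolded khinchine_bound_def, rule_format, OF that, of "?a n"] by (simp add: norm2 T_def)
    qed
    \<comment> \<open>The bound at \<open>n = 1\<close> forces this sign; it lets the final root of
      \<open>C powr p\<close> return \<open>C\<close>.\<close>
    have C0: "C \<ge> 0" by (rule order_trans[OF _ bound[of 1]]) (auto simp: moment_norm_def)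
    have ET: "expectation (\<lambda>\<omega>. \<bar>T n \<omega>\<bar> powr p) \<le> C powr p" if "n \<ge> 1" for n
    proof -
      have "expectation (\<lambda>\<omega>. \<bar>T n \<omega>\<bar> powr p) = moment_norm M p (T n) powr p"
        using p by (simp add: moment_norm_def powr_powr integral_nonneg_AE)
      also have "\<dots> \<le> C powr p" using bound[OF that] p by (intro powr_mono2) (auto simp: moment_norm_def)
      finally show ?thesis .
    qed
    have "m \<le> C powr p"
      unfolding m_def
    proof (rule std_normal_abs_powr_le_of_truncated)
      fix k :: nat
      let ?h = "\<lambda>y::real. min (\<bar>y\<bar> powr p) (real k)"
      have "(\<lambda>n. LINT y|distr M borel (T n). ?h y) \<longlonglongrightarrow> (LINT y|std_normal_distribution. ?h y)"
      proof (rule weak_conv_imp_integral_bdd_continuous_conv)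
        show "weak_conv_m (\<lambda>n. distr M borel (T n)) std_normal_distribution"
          unfolding T_def by (rule weighted_sum_central_limit[OF ind L unif])
        show "isCont ?h x" for x
        proof -
          have "continuous_on UNIV ?h"
            using p by (intro continuous_intros continuous_on_powr') auto
          then show ?thesis by (simp add: continuous_on_eq_continuous_at)
        qed
        show "norm (?h x) \<le> real k" for x by simp
      qed (auto intro: real_dist_normal_dist real_distribution_distr)
      \<comment> \<open>Truncation only lowers the integrand, so the moment bound survives it and
        passes to the weak limit.\<close>
      moreover have "(LINT y|distr M borel (T n). ?h y) \<le> C powr p" if "n \<ge> 1" for n
      proof -
        have "integrable M (\<lambda>\<omega>. \<bar>T n \<omega>\<bar> powr p)"
          using expectation_weighted_sum[OF ind L unif, of "\<lambda>x. \<bar>x\<bar> powr p" 0 n "?a n"] by (simp add: T_def)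
        moreover have "integrable M (\<lambda>\<omega>. ?h (T n \<omega>))"
          by (rule integrable_const_bound[where B = "real k"]) auto
        ultimately have "expectation (\<lambda>\<omega>. ?h (T n \<omega>)) \<le> expectation (\<lambda>\<omega>. \<bar>T n \<omega>\<bar> powr p)"
          by (intro integral_mono) auto
        then show ?thesis using ET[OF that] by (simp add: integral_distr)
      qed
      ultimately show "(LINT y|std_normal_distribution. ?h y) \<le> C powr p"
        by (intro LIMSEQ_le_const2) auto
    qed (use p in simp)
    then have "m powr (1 / p) \<le> (C powr p) powr (1 / p)" using m0 p by (intro powr_mono2) auto
    then show ?thesis using p C0 by (simp add: normG powr_powr)
  qed
  show ?thesis using upper lower by blast
qed

end
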